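(* Let $q$ be an odd prime power, let $d$ be an odd prime such that $d\mid(q-1)$, and let $\gamma$ be a primitive $d$th root of unity in $\mathbb{F}_q^*$. (i) If $q\equiv 1\pmod 4$ and $2\le k\le s$, then for any integer $n\ge k$ the polynomial $\Phi_{2^nd}(x)$ factors over $\mathbb{F}_q$ into $2^{k-1}(d-1)$ factors as $$\Phi_{2^nd}(x)=\prod_{\substack{1\le i\le 2^{k-1}\\ 1\le j\le d-1}}\bigl(x^{2^{n-k}}-\alpha_{2^k}^{2i-1}\gamma^j\bigr).$$ All these factors of $\Phi_{2^nd}(x)$ are irreducible over $\mathbb{F}_q$ when $k=s$. (ii) If $q\equiv 3\pmod 4$ and $3\le k\le u$, then for any integer $n\ge k$ the polynomial $\Phi_{2^nd}(x)$ factors over $\mathbb{F}_q$ into $2^{k-2}(d-1)$ factors as $$\Phi_{2^nd}(x)=\prod_{\substack{1\le i\le 2^{k-3}\\ 1\le j\le d-1}}\bigl(x^{2^{n-k+1}}\pm\gamma^j\,\mathbb{T}(\beta_{2^k}^{2i-1})\,x^{2^{n-k}}+\chi(\beta_{2^k})\gamma^{2j}\bigr).$$ All these factors of $\Phi_{2^nd}(x)$ are irreducible over $\mathbb{F}_q$ when $k=u$.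
   Context: $\mathbb{F}_q$ is the finite field with $q$ elements, and $q=2^st+1$ with $s\ge 1$ and $t$ odd. $\Phi_m(x)$ denotes the $m$th cyclotomic polynomial, viewed over $\mathbb{F}_q$. For $0\le k\le s$, $\alpha_{2^k}$ is a primitive $2^k$th root of unity in $\mathbb{F}_q^*$. When $q\equiv 3\pmod 4$, put $Q=q^2=2^uv+1$ with $v$ odd (so $u\ge 3$); for $0\le k\le u$, $\beta_{2^k}$ is a primitive $2^k$th root of unity in $\mathbb{F}_Q^*$; $\mathbb{T}:\mathbb{F}_Q\to\mathbb{F}_q$ is the trace $\mathbb{T}(x)=x+x^q$; and $\chi(\beta_{2^k})=\beta_{2^k}^{q+1}$, which equals $1$ if $0\le k<u$ and $-1$ if $k=u$. A factor written with $\pm$ in a product stands for the product of the two factors obtained from the two sign choices. *)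

theory Defs
  imports
    Complex_Main
    "HOL-Library.Cardinality"
    "HOL-Computational_Algebra.Computational_Algebra"
    "HOL-Number_Theory.Cong"
    "HOL-Number_Theory.Prime_Powers"
begin

section \<open>Primitive roots of unity and cyclotomic polynomials\<close>

definition primitive_root_of_unity :: "nat \<Rightarrow> 'a::monoid_mult \<Rightarrow> bool" where
  "primitive_root_of_unity m z \<longleftrightarrow>
     m > 0 \<and> z ^ m = 1 \<and> (\<forall>k. 0 < k \<and> k < m \<longrightarrow> z ^ k \<noteq> 1)"

definition cyclotomic_complex :: "nat \<Rightarrow> complex poly" where
  "cyclotomic_complex m = (\<Prod>z | primitive_root_of_unity m z. [:- z, 1:])"

text \<open>
  There is exactly one such integral polynomial for every \<open>m\<close>; see \<open>of_int_cyclotomic_int\<close>.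
\<close>
definition cyclotomic_int :: "nat \<Rightarrow> int poly" where
  "cyclotomic_int m = (THE p. map_poly of_int p = cyclotomic_complex m)"

definition cyclotomic :: "nat \<Rightarrow> 'a::comm_ring_1 poly" where
  "cyclotomic m = map_poly of_int (cyclotomic_int m)"

lemma map_poly_of_int_add:
  "map_poly of_int (p + q) = (map_poly of_int p + map_poly of_int q :: 'a::comm_ring_1 poly)"
  by (rule poly_eqI) (simp add: coeff_map_poly)

lemma map_poly_of_int_mult:
  "map_poly of_int (p * q) = (map_poly of_int p * map_poly of_int q :: 'a::comm_ring_1 poly)"
  by (rule poly_eqI) (simp add: coeff_map_poly coeff_mult)

lemma map_poly_of_int_prod:
  "map_poly of_int (\<Prod>x\<in>A. f x) = (\<Prod>x\<in>A. map_poly of_int (f x) :: 'a::comm_ring_1 poly)"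
  by (induction A rule: infinite_finite_induct) (simp_all add: map_poly_of_int_mult)

lemma map_poly_of_int_inj:
  "map_poly of_int p = (map_poly of_int q :: 'a::{comm_ring_1,ring_char_0} poly) \<longleftrightarrow> p = q"
  by (auto simp: poly_eq_iff coeff_map_poly)

lemma degree_map_poly_of_int:
  "degree (map_poly of_int p :: 'a::{comm_ring_1,ring_char_0} poly) = degree p"
  by (rule degree_map_poly) auto

lemma primitive_root_of_unity_dvd:
  assumes "primitive_root_of_unity m z" "z ^ n = 1"
  shows "m dvd n"
proof (rule ccontr)
  assume "\<not> m dvd n"
  hence "0 < n mod m" "n mod m < m"
    using assms(1) by (auto simp: primitive_root_of_unity_def dvd_eq_mod_eq_0)
  moreover have "z ^ n = z ^ (m * (n div m) + n mod m)"
    by simp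
  hence "z ^ (n mod m) = 1"
    using assms unfolding power_add power_mult by (simp add: primitive_root_of_unity_def)
  ultimately show False
    using assms(1) by (auto simp: primitive_root_of_unity_def)
qed

lemma roots_of_unity_eq_Union:
  fixes m :: nat assumes "m > 0"
  shows "{z::'a::monoid_mult. z ^ m = 1} = (\<Union>d\<in>{d. d dvd m}. {z. primitive_root_of_unity d z})"
proof (intro equalityI subsetI)
  fix z :: 'a assume "z \<in> {z. z ^ m = 1}"
  hence z: "m > 0 \<and> z ^ m = 1" using assms by simp
  define d where "d = (LEAST d. d > 0 \<and> z ^ d = 1)"
  have d: "d > 0 \<and> z ^ d = 1"
    unfolding d_def by (rule LeastI) (rule z)
  have "primitive_root_of_unity d z"
    unfolding primitive_root_of_unity_def using d not_less_Least[of _ "\<lambda>d. d > 0 \<and> z ^ d = 1"]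
    by (auto simp: d_def)
  with z show "z \<in> (\<Union>d\<in>{d. d dvd m}. {z. primitive_root_of_unity d z})"
    using primitive_root_of_unity_dvd by blast
next
  fix z :: 'a assume "z \<in> (\<Union>d\<in>{d. d dvd m}. {z. primitive_root_of_unity d z})"
  thus "z \<in> {z. z ^ m = 1}"
    by (auto simp: primitive_root_of_unity_def power_mult elim!: dvdE)
qed

lemma primitive_root_of_unity_unique:
  "primitive_root_of_unity m z \<Longrightarrow> primitive_root_of_unity n z \<Longrightarrow> m = n"
  using primitive_root_of_unity_dvd by (metis dvd_antisym primitive_root_of_unity_def)

lemma finite_primitive_roots_complex: "finite {z::complex. primitive_root_of_unity m z}"
proof (cases "m > 0")
  case True
  show ?thesis
    by (rule finite_subset[OF _ finite_roots_unity[of m]])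
       (use True in \<open>auto simp: primitive_root_of_unity_def\<close>)
qed (auto simp: primitive_root_of_unity_def)

lemma prod_cyclotomic_complex:
  assumes "m > 0"
  shows "(\<Prod>d | d dvd m. cyclotomic_complex d) = monom 1 m - 1"
proof -
  have "(\<Prod>d | d dvd m. cyclotomic_complex d) =
          (\<Prod>z\<in>(\<Union>d\<in>{d. d dvd m}. {z. primitive_root_of_unity d z}). [:- z, 1:])"
    unfolding cyclotomic_complex_def
    by (rule prod.UNION_disjoint [symmetric])
       (use assms in \<open>auto simp: finite_primitive_roots_complex dest: primitive_root_of_unity_unique\<close>)
  also have "\<dots> = (\<Prod>z | z ^ m = 1. [:- z, 1:])"
    by (simp only: roots_of_unity_eq_Union[OF assms])
  also have "\<dots> = monom 1 m - 1"
  proof (rule poly_eqI_degree_lead_coeff[where n = m and A = "{z::complex. z ^ m = 1}"])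
    have fin: "finite {z::complex. z ^ m = 1}"
      using finite_roots_unity[of m] assms by simp
    have deg: "degree (\<Prod>z | z ^ m = 1. [:- z, 1::complex:]) = m"
      using assms by (subst degree_prod_eq_sum_degree) (auto simp: card_roots_unity_eq)
    have "lead_coeff (\<Prod>z | z ^ m = 1. [:- z, 1::complex:]) = 1"
      by (subst lead_coeff_prod) simp
    thus "coeff (\<Prod>z | z ^ m = 1. [:- z, 1::complex:]) m = coeff (monom 1 m - 1) m"
      using assms by (simp add: deg)
    show "degree (\<Prod>z | z ^ m = 1. [:- z, 1::complex:]) \<le> m"
      by (simp add: deg)
    show "degree (monom 1 m - 1 :: complex poly) \<le> m"
      by (rule degree_diff_le) (simp_all add: degree_monom_le)
    show "poly (\<Prod>z | z ^ m = 1. [:- z, 1:]) x = poly (monom 1 m - 1) x"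
      if "x \<in> {z::complex. z ^ m = 1}" for x
      using that fin by (auto simp: poly_prod poly_monom)
  qed (use assms in \<open>simp add: card_roots_unity_eq\<close>)
  finally show ?thesis .
qed

lemma lead_coeff_cyclotomic_complex: "lead_coeff (cyclotomic_complex m) = 1"
  by (simp add: cyclotomic_complex_def lead_coeff_prod)

lemma int_poly_quotient:
  fixes A B :: "int poly" and C :: "complex poly"
  assumes "lead_coeff B = 1" "map_poly of_int A = map_poly of_int B * C"
  shows "\<exists>p. map_poly of_int p = C"
proof -
  obtain q r where qr: "pseudo_divmod A B = (q, r)"
    by (cases "pseudo_divmod A B")
  have B: "B \<noteq> 0" using assms(1) by auto
  have A: "A = B * q + r" and r: "r = 0 \<or> degree r < degree B"
    using pseudo_divmod[OF B qr] assms(1) by simp_all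
  let ?h = "map_poly of_int :: int poly \<Rightarrow> complex poly"
  have eq: "?h r = ?h B * (C - ?h q)"
    using assms(2) by (simp add: A map_poly_of_int_add map_poly_of_int_mult algebra_simps)
  have "C = ?h q"
  proof (rule ccontr)
    assume "C \<noteq> ?h q"
    moreover have "?h B \<noteq> 0"
      using B map_poly_of_int_inj[of B 0, where ?'a = complex] by simp
    ultimately have "degree (?h r) \<ge> degree (?h B)" "?h r \<noteq> 0"
      unfolding eq by (auto simp: degree_mult_eq)
    with r show False by (auto simp: degree_map_poly_of_int)
  qed
  thus ?thesis by blast
qed

lemma of_int_cyclotomic_int: "map_poly of_int (cyclotomic_int m) = cyclotomic_complex m"
proof -
  have ex: "\<exists>p. map_poly of_int p = cyclotomic_complex m"
  proof (induction m rule: less_induct)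
    case (less m)
    show ?case
    proof (cases "m = 0")
      case True
      thus ?thesis
        by (intro exI[of _ 1]) (simp add: cyclotomic_complex_def primitive_root_of_unity_def)
    next
      case False
      define D where "D = {d. d dvd m} - {m}"
      have fin: "finite {d. d dvd m}" using False by simp
      have lt: "d < m" if "d \<in> D" for d
        using that False by (auto simp: D_def intro!: le_neq_implies_less dvd_imp_le)
      have "\<forall>d\<in>D. \<exists>p. map_poly of_int p = cyclotomic_complex d"
        using less.IH lt by blast
      then obtain f where f: "\<And>d. d \<in> D \<Longrightarrow> map_poly of_int (f d) = cyclotomic_complex d"
        by metis
      have h: "map_poly of_int (\<Prod>d\<in>D. f d) = (\<Prod>d\<in>D. cyclotomic_complex d)"
        using f by (simp add: map_poly_of_int_prod)
      have lc: "lead_coeff (\<Prod>d\<in>D. f d) = 1"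
      proof -
        have "complex_of_int (lead_coeff (\<Prod>d\<in>D. f d)) =
                lead_coeff (map_poly of_int (\<Prod>d\<in>D. f d) :: complex poly)"
          by (simp add: degree_map_poly_of_int coeff_map_poly)
        also have "\<dots> = 1"
          unfolding h lead_coeff_prod by (simp add: lead_coeff_cyclotomic_complex)
        finally show ?thesis by (simp only: of_int_eq_1_iff)
      qed
      have "map_poly of_int (monom 1 m - 1) = (monom 1 m - 1 :: complex poly)"
        by (rule poly_eqI) (simp add: coeff_map_poly coeff_1 if_distrib)
      also have "\<dots> = (\<Prod>d\<in>insert m D. cyclotomic_complex d)"
        using False by (subst prod_cyclotomic_complex [symmetric])
                       (auto simp: D_def intro!: prod.cong)
      also have "\<dots> = map_poly of_int (\<Prod>d\<in>D. f d) * cyclotomic_complex m"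
        using fin by (subst prod.insert) (auto simp: D_def h [unfolded D_def] mult.commute)
      finally show ?thesis
        by (rule int_poly_quotient[OF lc])
    qed
  qed
  have "\<exists>!p. map_poly of_int p = cyclotomic_complex m"
    using ex by (metis map_poly_of_int_inj)
  thus ?thesis unfolding cyclotomic_int_def by (rule theI')
qed

section \<open>Trace and norm of a quadratic extension of finite fields\<close>

definition field_embedding :: "('a::field \<Rightarrow> 'b::field) \<Rightarrow> bool" where
  "field_embedding \<iota> \<longleftrightarrow> \<iota> 1 = 1 \<and>
     (\<forall>x y. \<iota> (x + y) = \<iota> x + \<iota> y) \<and> (\<forall>x y. \<iota> (x * y) = \<iota> x * \<iota> y)"

text \<open>
  For an embedding \<open>\<iota>\<close> of the field with \<open>q\<close> elements into the field with \<open>q\<^sup>2\<close> elements,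
  these are \<open>x + x\<^sup>q\<close> and \<open>x\<^bsup>q+1\<^esup>\<close>, pulled back along \<open>\<iota>\<close>; both lie in the range
  of \<open>\<iota>\<close> by \<open>embed_quad_trace\<close> and \<open>embed_quad_norm\<close>.
\<close>
definition quad_trace :: "('a::finite_field \<Rightarrow> 'b::finite_field) \<Rightarrow> 'b \<Rightarrow> 'a" where
  "quad_trace \<iota> x = inv \<iota> (x + x ^ CARD('a))"

definition quad_norm :: "('a::finite_field \<Rightarrow> 'b::finite_field) \<Rightarrow> 'b \<Rightarrow> 'a" where
  "quad_norm \<iota> x = inv \<iota> (x ^ (CARD('a) + 1))"

lemma field_embedding_power:
  "field_embedding \<iota> \<Longrightarrow> \<iota> (x ^ n) = \<iota> x ^ n"
  by (induction n) (simp_all add: field_embedding_def)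

lemma field_embedding_inj:
  fixes \<iota> :: "'a::field \<Rightarrow> 'b::field"
  assumes "field_embedding \<iota>"
  shows "inj \<iota>"
proof (rule injI, rule ccontr)
  fix x y assume xy: "\<iota> x = \<iota> y" "x \<noteq> y"
  have "\<iota> x = \<iota> (y + (x - y))" by simp
  also have "\<dots> = \<iota> y + \<iota> (x - y)"
    using assms unfolding field_embedding_def by blast
  finally have "\<iota> (x - y) = 0" using xy by simp
  moreover have "\<iota> ((x - y) * inverse (x - y)) = \<iota> (x - y) * \<iota> (inverse (x - y))"
    using assms unfolding field_embedding_def by blast
  ultimately show False
    using xy assms by (simp add: field_embedding_def)
qed

lemma range_field_embedding:
  fixes \<iota> :: "'a::finite_field \<Rightarrow> 'b::finite_field"
  assumes "field_embedding \<iota>"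
  shows "range \<iota> = {y. y ^ CARD('a) = y}"
proof (rule card_seteq)
  show "range \<iota> \<subseteq> {y. y ^ CARD('a) = y}"
    using field_embedding_power[OF assms]
    by (metis (mono_tags, lifting) finite_field_power_card_eq_same image_subsetI mem_Collect_eq)
  let ?p = "monom 1 CARD('a) - monom 1 1 :: 'b poly"
  have two: "CARD('a) > 1"
    using card_mono[of UNIV "{0, 1 :: 'a}"] by simp
  have "coeff ?p CARD('a) \<noteq> 0" using two by simp
  hence "?p \<noteq> 0" by (metis coeff_0)
  hence "card {y. poly ?p y = 0} \<le> degree ?p"
    by (rule card_poly_roots_bound)
  also have "degree ?p \<le> CARD('a)"
    using two by (intro degree_diff_le) (simp_all add: degree_monom_eq)
  finally show "card {y::'b. y ^ CARD('a) = y} \<le> card (range \<iota>)"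
    by (simp add: poly_monom card_image field_embedding_inj[OF assms])
qed simp

lemma of_nat_CARD_eq_0: "of_nat CARD('a) = (0 :: 'a::finite_field)"
proof -
  have "(\<Sum>x\<in>UNIV. x :: 'a) = (\<Sum>x\<in>UNIV. x + 1)"
    by (rule sum.reindex_bij_witness[of _ "\<lambda>x. x + 1" "\<lambda>x. x - 1"]) auto
  thus ?thesis by (simp add: sum.distrib)
qed

lemma embed_quad_trace:
  fixes \<iota> :: "'a::finite_field \<Rightarrow> 'b::finite_field"
  assumes "field_embedding \<iota>" "primepow CARD('a)" "CARD('b) = CARD('a)\<^sup>2"
  shows "\<iota> (quad_trace \<iota> x) = x + x ^ CARD('a)"
proof -
  obtain p k where p: "prime p" "CARD('a) = p ^ k"
    using assms(2) unfolding primepow_def by blast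
  have "CHAR('b) dvd CARD('b)"
    using of_nat_CARD_eq_0[where ?'a = 'b] by (simp only: of_nat_eq_0_iff_char_dvd)
  hence "CHAR('b) dvd p"
    using p assms(3) by (metis CHAR_prime prime_dvd_power)
  hence "CHAR('b) = p"
    using p(1) CHAR_prime[where ?'a = 'b] primes_dvd_imp_eq by blast
  hence "(x + x ^ CARD('a)) ^ CARD('a) = x ^ CARD('a) + (x ^ CARD('a)) ^ CARD('a)"
    by (intro freshmans_dream'[where n = k]) (simp_all add: p)
  also have "(x ^ CARD('a)) ^ CARD('a) = x ^ CARD('b)"
    by (simp add: assms(3) power2_eq_square power_mult)
  also have "\<dots> = x" by (rule finite_field_power_card_eq_same)
  finally have "x + x ^ CARD('a) \<in> range \<iota>"
    by (simp add: range_field_embedding[OF assms(1)] add.commute)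
  thus ?thesis by (simp add: quad_trace_def f_inv_into_f)
qed

lemma embed_quad_norm:
  fixes \<iota> :: "'a::finite_field \<Rightarrow> 'b::finite_field"
  assumes "field_embedding \<iota>" "CARD('b) = CARD('a)\<^sup>2"
  shows "\<iota> (quad_norm \<iota> x) = x ^ (CARD('a) + 1)"
proof -
  have "(x ^ (CARD('a) + 1)) ^ CARD('a) = x ^ CARD('b) * x ^ CARD('a)"
    by (simp add: assms(2) power2_eq_square power_mult power_mult_distrib mult.commute)
  also have "\<dots> = x ^ (CARD('a) + 1)" by (simp add: finite_field_power_card_eq_same)
  finally have "x ^ (CARD('a) + 1) \<in> range \<iota>"
    by (simp add: range_field_embedding[OF assms(1)])
  thus ?thesis by (simp add: quad_norm_def f_inv_into_f)
qed

end

theory Submission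
  imports Defs
begin

text \<open>
  Put \<open>X = x\<^bsup>2^(n-1)\<^esup>\<close>. Since \<open>d\<close> is an odd prime, comparing the divisors of
  \<open>2\<^sup>n d\<close> with those of \<open>2\<^bsup>n-1\<^esup> d\<close> gives \<open>\<Phi> (2\<^sup>n d) \<cdot> (X + 1) = X\<^sup>d + 1\<close>.
  Over a field that contains \<open>\<gamma>\<close> the right-hand side is the product of the \<open>X + \<gamma>\<^bsup>jN\<^esup>\<close>,
  \<open>1 \<le> j \<le> d\<close>, for any \<open>N\<close> prime to \<open>d\<close>; the factor \<open>j = d\<close> is \<open>X + 1\<close>, and cancelling it leaves
  \<open>\<Phi> (2\<^sup>n d) = \<Prod>1\<le>j<d. X + (\<gamma>\<^sup>j)\<^sup>N\<close> (lemma \<open>cyclotomic_eq_prod\<close>). With \<open>N = 2\<^bsup>k-1\<^esup>\<close>,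
  \<open>y = x\<^bsup>2^(n-k)\<^esup>\<close> and \<open>c = \<gamma>\<^sup>j\<close> each factor is \<open>y\<^sup>N + c\<^sup>N\<close>, which remains to be split.

  If \<open>q \<equiv> 1 (mod 4)\<close>, it splits into the \<open>y - c \<alpha>\<^bsup>2i-1\<^esup>\<close>, because the odd powers of \<open>\<alpha>\<close> are the
  roots of \<open>y\<^sup>N + 1\<close>. If \<open>q \<equiv> 3 (mod 4)\<close>, the quadratic factor with sign \<open>\<epsilon>\<close> splits over the
  quadratic extension as \<open>(y + \<epsilon>cB)(y + \<epsilon>cD)\<close> with \<open>B = \<beta>\<^bsup>2i-1\<^esup>\<close> and \<open>D = B\<^sup>q\<close>. The two signs
  together give \<open>(y\<^sup>2 - c\<^sup>2 B\<^sup>2)(y\<^sup>2 - c\<^sup>2 D\<^sup>2)\<close>. The Frobenius inverts \<open>\<omega> = \<beta>\<^sup>2\<close>, whose order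
  \<open>2\<^bsup>k-1\<^esup>\<close> divides \<open>q + 1\<close>; so \<open>B\<^sup>2\<close> and \<open>D\<^sup>2\<close> are inverse odd powers of \<open>\<omega>\<close>, and the first case
  applies with \<open>y\<^sup>2\<close>, \<open>\<omega>\<close>, \<open>c\<^sup>2\<close> in place of \<open>y\<close>, \<open>\<alpha>\<close>, \<open>c\<close> (lemma \<open>prod_trace_factors\<close>).

  The number of factors and their irreducibility follow in both cases from the single fact that their
  product divides \<open>x\<^sup>M + 1\<close> with \<open>M = 2\<^bsup>n-1\<^esup> d\<close>. This polynomial is squarefree because \<open>M\<close> is
  invertible, so no factor can occur twice. If \<open>f\<close> is irreducible of degree \<open>m\<close> and divides
  \<open>x\<^sup>M + 1\<close>, then modulo \<open>f\<close> both \<open>x\<^bsup>q^m-1\<^esup> = 1\<close> and \<open>x\<^sup>M = -1\<close>; as \<open>d\<close> is odd, this forces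
  \<open>2\<^sup>n\<close> to divide \<open>q\<^sup>m - 1\<close> (lemma \<open>dvd_card_power_minus_one\<close>). The \<open>2\<close>-adic valuation of \<open>q\<^sup>m - 1\<close> then
  bounds \<open>m\<close> from below by a power of two, which for \<open>k = s\<close>, respectively \<open>k = u\<close>, is the degree of
  the factors of the theorem. A polynomial all of whose irreducible factors have at least its own
  degree is irreducible.
\<close>

section \<open>Products over orbits of roots of unity\<close>

text \<open>
  The homogeneous form of \<open>x\<^sup>d - 1 = \<Prod>(x - g\<^sup>j)\<close>. An arbitrary polynomial \<open>y\<close> in place of the variable
  makes the formula applicable to powers of \<open>x\<close> and to squares of such powers; it is obtained from the
  case \<open>y = x\<close>, where both sides are monic with the same \<open>d\<close> roots, by composition.
\<close>
lemma prod_minus_root_orbit: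
  fixes c g :: "'a::field" and y :: "'a poly"
  assumes g: "primitive_root_of_unity d g"
  shows "(\<Prod>j\<in>{1..d}. y - [:c * g ^ j:]) = y ^ d - [:c ^ d:]"
proof -
  have d: "d > 0" and gd: "g ^ d = 1" and g0: "g \<noteq> 0"
    using g by (auto simp: primitive_root_of_unity_def power_0_left split: if_splits)
  have inj: "inj_on (\<lambda>j. g ^ j) {1..d}"
  proof (rule linorder_inj_onI)
    fix i j assume ij: "i < j" "i \<in> {1..d}" "j \<in> {1..d}"
    show "g ^ i \<noteq> g ^ j"
    proof
      assume "g ^ i = g ^ j"
      moreover have "g ^ j = g ^ i * g ^ (j - i)" using ij by (simp flip: power_add)
      ultimately have "g ^ (j - i) = 1" using g0 by simp
      thus False using primitive_root_of_unity_dvd[OF g, of "j - i"] ij by (auto dest: dvd_imp_le)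
    qed
  qed auto
  have base: "(\<Prod>j\<in>{1..d}. [:0, 1:] - [:c * g ^ j:]) = [:0, 1:] ^ d - [:c ^ d:]"
  proof (cases "c = 0")
    case False
    let ?A = "(\<lambda>j. c * g ^ j) ` {1..d}"
    have lin: "(\<Prod>j\<in>{1..d}. [:0, 1:] - [:c * g ^ j:]) = (\<Prod>j\<in>{1..d}. [:- (c * g ^ j), 1:])"
      by simp
    have inj': "inj_on (\<lambda>j. c * g ^ j) {1..d}"
      by (rule inj_onI) (use False in \<open>auto intro: inj_onD[OF inj]\<close>)
    show ?thesis
    proof (rule poly_eqI_degree_lead_coeff[where n = d and A = ?A])
      have deg: "degree (\<Prod>j\<in>{1..d}. [:- (c * g ^ j), 1:]) = d"
        by (subst degree_prod_eq_sum_degree) auto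
      have "lead_coeff (\<Prod>j\<in>{1..d}. [:- (c * g ^ j), 1:]) = 1"
        by (subst lead_coeff_prod) simp
      hence "coeff (\<Prod>j\<in>{1..d}. [:- (c * g ^ j), 1:]) d = 1"
        by (simp only: deg)
      thus "coeff (\<Prod>j\<in>{1..d}. [:0, 1:] - [:c * g ^ j:]) d = coeff ([:0, 1:] ^ d - [:c ^ d:]) d"
        unfolding lin deg using d coeff_linear_power[of "0 :: 'a" d] by (simp add: coeff_pCons')
      show "degree (\<Prod>j\<in>{1..d}. [:0, 1:] - [:c * g ^ j:]) \<le> d"
        unfolding lin deg ..
      show "degree ([:0, 1:] ^ d - [:c ^ d:]) \<le> d"
        by (rule degree_diff_le) (simp_all add: degree_linear_power)
      show "card ?A \<ge> d" using inj' by (simp add: card_image)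
      fix x assume "x \<in> ?A"
      then obtain j where j: "j \<in> {1..d}" "x = c * g ^ j" by auto
      have "(g ^ j) ^ d = 1" by (metis gd power_commutes power_mult power_one mult.commute)
      hence "poly ([:0, 1:] ^ d - [:c ^ d:]) x = 0" by (simp add: j power_mult_distrib)
      moreover have "poly (\<Prod>j\<in>{1..d}. [:0, 1:] - [:c * g ^ j:]) x = 0"
        unfolding lin poly_prod using j by (intro prod_zero) auto
      ultimately show "poly (\<Prod>j\<in>{1..d}. [:0, 1:] - [:c * g ^ j:]) x = poly ([:0, 1:] ^ d - [:c ^ d:]) x"
        by simp
    qed
  qed (use d in \<open>simp add: power_0_left\<close>)
  have pw: "pcompose (p ^ n) y = pcompose p y ^ n" for p :: "'a poly" and n
    by (induction n) (simp_all add: pcompose_mult pcompose_1)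
  have X: "pcompose [:0, 1:] y = y" and const: "pcompose [:a:] y = [:a:]" for a
    by (simp_all add: pcompose_pCons)
  show ?thesis
    using arg_cong[OF base, of "\<lambda>p. pcompose p y"]
    by (simp only: pcompose_prod pcompose_diff pw X const)
qed

lemma primitive_root_of_unity_half_power:
  fixes a :: "'a::field"
  assumes "primitive_root_of_unity (2 * N) a"
  shows "a ^ N = -1"
proof -
  have "(a ^ N)\<^sup>2 = 1" "a ^ N \<noteq> 1"
    using assms by (auto simp: primitive_root_of_unity_def mult.commute simp flip: power_mult)
  thus ?thesis by (simp add: power2_eq_1_iff)
qed

lemma primitive_root_of_unity_square:
  assumes "primitive_root_of_unity (2 * N) a"
  shows "primitive_root_of_unity N (a\<^sup>2)"
  using assms by (auto simp: primitive_root_of_unity_def simp flip: power_mult)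

lemma primitive_root_of_unity_coprime_power:
  assumes g: "primitive_root_of_unity d g" and "coprime N d"
  shows "primitive_root_of_unity d (g ^ N)"
  unfolding primitive_root_of_unity_def
proof (intro conjI allI impI)
  show "d > 0" "(g ^ N) ^ d = 1"
    using g by (auto simp: primitive_root_of_unity_def simp flip: power_mult)
       (metis mult.commute power_mult power_one)
  fix k assume k: "0 < k \<and> k < d"
  show "(g ^ N) ^ k \<noteq> 1"
  proof
    assume "(g ^ N) ^ k = 1"
    hence "d dvd N * k" using primitive_root_of_unity_dvd[OF g] by (simp add: power_mult)
    hence "d dvd k" using \<open>coprime N d\<close> by (simp add: coprime_commute coprime_dvd_mult_right_iff)
    thus False using k by (auto dest: dvd_imp_le)
  qed
qed

text \<open>
  The odd powers of \<open>a\<close> are the multiples of \<open>a\<^sup>-\<^sup>1\<close> by the powers of the primitive \<open>N\<close>th root \<open>a\<^sup>2\<close>,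
  so this is \<open>prod_minus_root_orbit\<close> for \<open>c / a\<close>, where \<open>(c / a)\<^sup>N = - c\<^sup>N\<close>.
\<close>
lemma prod_minus_odd_powers:
  fixes a c :: "'a::field" and y :: "'a poly"
  assumes a: "primitive_root_of_unity (2 * N) a"
  shows "(\<Prod>i\<in>{1..N}. y - [:c * a ^ (2 * i - 1):]) = y ^ N + [:c ^ N:]"
proof -
  have a0: "a \<noteq> 0"
    using a by (auto simp: primitive_root_of_unity_def power_0_left split: if_splits)
  have "(\<Prod>i\<in>{1..N}. y - [:c * a ^ (2 * i - 1):]) = (\<Prod>i\<in>{1..N}. y - [:c / a * (a\<^sup>2) ^ i:])"
  proof (rule prod.cong)
    fix i assume "i \<in> {1..N}"
    then obtain i' where "i = Suc i'" by (cases i) auto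
    thus "y - [:c * a ^ (2 * i - 1):] = y - [:c / a * (a\<^sup>2) ^ i:]"
      using a0 by (simp add: field_simps flip: power_mult power_add mult_2)
  qed simp
  also have "\<dots> = y ^ N - [:(c / a) ^ N:]"
    by (rule prod_minus_root_orbit[OF primitive_root_of_unity_square[OF a]])
  also have "\<dots> = y ^ N + [:c ^ N:]"
    by (simp add: power_divide primitive_root_of_unity_half_power[OF a])
  finally show ?thesis .
qed

section \<open>Cyclotomic polynomials of order a power of two times an odd prime\<close>

text \<open>
  For odd \<open>m\<close> and \<open>K = 2\<^bsup>n-1\<^esup>\<close>, the divisors of \<open>2Km\<close> that do not divide \<open>Km\<close> are the \<open>2\<^sup>n e\<close> with
  \<open>e\<close> dividing \<open>m\<close>, so that the product of their cyclotomic polynomials is \<open>(x\<^bsup>2Km\<^esup> - 1) / (x\<^bsup>Km\<^esup> - 1)\<close>.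
  The claim is this identity for \<open>m = d\<close> with the one for \<open>m = 1\<close> substituted. It is a statement about
  integer polynomials, hence can be proved over the complex numbers and then transported to any ring.
\<close>
lemma cyclotomic_two_power_prime_mult:
  assumes "n \<ge> 1" "prime d" "odd d"
  shows "cyclotomic (2 ^ n * d) * (monom 1 (2 ^ (n - 1)) + 1) =
    (monom 1 (2 ^ (n - 1) * d) + 1 :: 'a::comm_ring_1 poly)"
proof -
  let ?C = "cyclotomic_complex" and ?K = "2 ^ (n - 1) :: nat"
  have n: "2 ^ n = 2 * ?K" using assms by (cases n) auto
  have dvd_twice: "{e. e dvd 2 * ?K * m} = {e. e dvd ?K * m} \<union> {2 ^ n * e | e. e dvd m}" if "odd m" for m
  proof -
    have "e dvd ?K * m" if e: "e dvd 2 ^ n * m" "\<not> (\<exists>f. e = 2 ^ n * f \<and> f dvd m)" for e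
    proof -
      obtain b c where bc: "e = b * c" "b dvd 2 ^ n" "c dvd m" using division_decomp[OF e(1)] by blast
      obtain i where i: "i \<le> n" "b = 2 ^ i" using bc(2) divides_primepow_nat[of 2 b n] by auto
      have "i \<noteq> n" using bc e(2) i by auto
      hence "b dvd ?K" unfolding i using i(1) by (intro le_imp_power_dvd) simp
      thus ?thesis using bc by (simp add: mult_dvd_mono)
    qed
    moreover have "e dvd 2 * ?K * m" if "e dvd ?K * m" for e
      using that by (simp add: mult.assoc)
    ultimately show ?thesis unfolding n by fastforce
  qed
  have disj: "{e. e dvd ?K * m} \<inter> {2 ^ n * e | e. e dvd m} = {}" if "odd m" for m
  proof -
    have "\<not> 2 ^ n * e dvd ?K * m" for e
    proof
      assume "2 ^ n * e dvd ?K * m"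
      moreover have "?K * 2 dvd 2 ^ n * e" unfolding n by simp
      ultimately have "?K * 2 dvd ?K * m" by (rule dvd_trans[rotated])
      thus False using that by simp
    qed
    thus ?thesis by auto
  qed
  have key: "(monom 1 (?K * m) + 1) = (\<Prod>e\<in>{2 ^ n * e | e. e dvd m}. ?C e)" if m: "odd m" for m
  proof -
    have m0: "m > 0" using m by (cases m) auto
    have fin: "finite {e. e dvd ?K * m}" "finite {2 ^ n * e | e. e dvd m}"
      using m0 by auto
    have "(monom 1 (?K * m) - 1) * (monom 1 (?K * m) + 1) = (monom 1 (2 * ?K * m) - 1 :: complex poly)"
      by (simp add: algebra_simps mult_monom) (simp add: algebra_simps flip: mult_2)
    also have "\<dots> = (\<Prod>e | e dvd 2 * ?K * m. ?C e)"
      using m0 by (subst prod_cyclotomic_complex) auto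
    also have "\<dots> = (\<Prod>e | e dvd ?K * m. ?C e) * (\<Prod>e\<in>{2 ^ n * e | e. e dvd m}. ?C e)"
      unfolding dvd_twice[OF m] using fin disj[OF m] by (rule prod.union_disjoint)
    also have "(\<Prod>e | e dvd ?K * m. ?C e) = monom 1 (?K * m) - 1"
      using m0 by (subst prod_cyclotomic_complex) auto
    finally have "(monom 1 (?K * m) - 1) * (monom 1 (?K * m) + 1) = (monom 1 (?K * m) - 1) * (\<Prod>e\<in>{2 ^ n * e | e. e dvd m}. ?C e)" .
    moreover have "monom 1 (?K * m) - 1 \<noteq> (0 :: complex poly)"
      using m0 by (auto simp: poly_eq_iff intro!: exI[of _ "?K * m"])
    ultimately show ?thesis by simp
  qed
  have "{2 ^ n * e | e. e dvd 1} = {2 ^ n :: nat}" by auto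
  hence one: "monom 1 ?K + 1 = ?C (2 ^ n)" using key[of 1] by simp
  have "e = 1 \<or> e = d" if "e dvd d" for e using assms that by (auto simp: prime_nat_iff)
  hence "{2 ^ n * e | e. e dvd d} = {2 ^ n, 2 ^ n * d :: nat}"  by force
  moreover have "2 ^ n \<noteq> 2 ^ n * d" using assms prime_gt_1_nat[of d] by simp
  ultimately have C: "?C (2 ^ n * d) * (monom 1 ?K + 1) = monom 1 (?K * d) + 1"
    using key[of d] assms unfolding one by simp
  have mono: "map_poly of_int (monom 1 m + 1) = (monom 1 m + 1 :: 'b::comm_ring_1 poly)" for m
    by (rule poly_eqI) (simp add: coeff_map_poly coeff_1 if_distrib)
  have "(map_poly of_int (cyclotomic_int (2 ^ n * d) * (monom 1 ?K + 1)) :: complex poly)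
       = map_poly of_int (monom 1 (?K * d) + 1)"
    unfolding map_poly_of_int_mult of_int_cyclotomic_int mono C ..
  hence "cyclotomic_int (2 ^ n * d) * (monom 1 ?K + 1) = monom 1 (?K * d) + 1"
    by (simp only: map_poly_of_int_inj)
  hence "map_poly of_int (cyclotomic_int (2 ^ n * d) * (monom 1 ?K + 1)) =
      (map_poly of_int (monom 1 (?K * d) + 1) :: 'a poly)"
    by (rule arg_cong)
  thus ?thesis unfolding map_poly_of_int_mult mono cyclotomic_def .
qed

text \<open>
  The freedom in the exponent \<open>N\<close> lets the constant terms be chosen as \<open>N\<close>th powers of \<open>\<gamma>\<^sup>j\<close>, which
  is the shape in which the factors can be split further.
\<close>
lemma cyclotomic_eq_prod:
  fixes g :: "'a::field"
  assumes "n \<ge> 1" "prime d" "odd d" and g: "primitive_root_of_unity d g" and "coprime N d"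
  shows "cyclotomic (2 ^ n * d) = (\<Prod>j\<in>{1..d-1}. monom 1 (2 ^ (n - 1)) + [:(g ^ j) ^ N:])"
proof -
  let ?Y = "monom 1 (2 ^ (n - 1)) :: 'a poly"
  have g': "primitive_root_of_unity d (g ^ N)"
    using assms by (intro primitive_root_of_unity_coprime_power)
  have d: "d > 0" "(g ^ N) ^ d = 1" using g' by (auto simp: primitive_root_of_unity_def)
  have diff_pCons_minus: "p - [:- a:] = p + [:a:]" for p :: "'a poly" and a
    by (metis diff_minus_eq_add minus_pCons minus_zero)
  have "{1..d} = insert d {1..d - 1}" using d by auto
  \<comment> \<open>With \<open>c = -1\<close> the orbit formula gives \<open>Y\<^sup>d + 1\<close>, as \<open>d\<close> is odd.\<close>
  hence "(\<Prod>j\<in>{1..d - 1}. ?Y + [:(g ^ j) ^ N:]) * (?Y + 1) = (\<Prod>j\<in>{1..d}. ?Y - [:-1 * (g ^ N) ^ j:])"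
    using d by (simp add: mult.commute one_pCons diff_pCons_minus flip: power_mult)
  also have "\<dots> = ?Y ^ d - [:(-1) ^ d:]"
    by (rule prod_minus_root_orbit[OF g'])
  also have "\<dots> = cyclotomic (2 ^ n * d) * (?Y + 1)"
    using assms cyclotomic_two_power_prime_mult[of n d, where ?'a = 'a] by (simp add: monom_power one_pCons)
  finally have eq: "(\<Prod>j\<in>{1..d - 1}. ?Y + [:(g ^ j) ^ N:]) * (?Y + 1) = \<dots>" .
  have "coeff (?Y + 1) (2 ^ (n - 1)) \<noteq> 0" by simp
  hence "?Y + 1 \<noteq> 0" by (metis coeff_0)
  thus ?thesis using eq by simp
qed

section \<open>Quadratic factors from traces\<close>

lemma map_poly_field_embedding:
  fixes \<iota> :: "'a::field \<Rightarrow> 'b::field"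
  assumes "field_embedding \<iota>"
  shows "map_poly \<iota> (p + q) = map_poly \<iota> p + map_poly \<iota> q"
    and "map_poly \<iota> (p * q) = map_poly \<iota> p * map_poly \<iota> q"
    and "map_poly \<iota> (p ^ n) = map_poly \<iota> p ^ n"
    and "map_poly \<iota> (prod f A) = (\<Prod>x\<in>A. map_poly \<iota> (f x))"
    and "map_poly \<iota> [:c:] = [:\<iota> c:]"
    and "inj (map_poly \<iota>)"
proof -
  have add: "\<iota> (x + y) = \<iota> x + \<iota> y" and mult: "\<iota> (x * y) = \<iota> x * \<iota> y" and one: "\<iota> 1 = 1" for x y
    using assms by (auto simp: field_embedding_def)
  have zero: "\<iota> 0 = 0" using add[of 0 1] one by simp
  have sum: "\<iota> (sum f A) = (\<Sum>x\<in>A. \<iota> (f x))" for f :: "nat \<Rightarrow> 'a" and A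
    by (induction A rule: infinite_finite_induct) (simp_all add: zero add)
  show "map_poly \<iota> (p + q) = map_poly \<iota> p + map_poly \<iota> q"
    by (rule poly_eqI) (simp add: coeff_map_poly zero add)
  show *: "map_poly \<iota> (p * q) = map_poly \<iota> p * map_poly \<iota> q" for p q
    by (rule poly_eqI) (simp add: coeff_map_poly zero coeff_mult sum mult)
  show c: "map_poly \<iota> [:c:] = [:\<iota> c:]" for c
    by (rule poly_eqI) (simp add: coeff_map_poly zero coeff_pCons split: nat.split)
  show "map_poly \<iota> (p ^ n) = map_poly \<iota> p ^ n"
    using c[of 1] by (induction n) (simp_all add: * one flip: one_pCons)
  show "map_poly \<iota> (prod f A) = (\<Prod>x\<in>A. map_poly \<iota> (f x))"
    using c[of 1] by (induction A rule: infinite_finite_induct) (simp_all add: * one flip: one_pCons)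
  show "inj (map_poly \<iota>)"
    using field_embedding_inj[OF assms]
    by (auto simp: inj_def poly_eq_iff coeff_map_poly zero)
qed

text \<open>
  The product over odd exponents up to \<open>2K - 1\<close> on the left uses only half of the odd powers of
  \<open>\<omega> = \<beta>\<^sup>2\<close>; the other half are their inverses, that is, their conjugates over the small field.
  The identity is checked after mapping both sides injectively into the extension.
\<close>
lemma prod_trace_factors:
  fixes \<iota> :: "'a::finite_field \<Rightarrow> 'b::finite_field" and y :: "'a poly" and c :: 'a
  assumes \<iota>: "field_embedding \<iota>" and q: "primepow CARD('a)" "CARD('b) = CARD('a)\<^sup>2" "odd CARD('a)"
    and K: "K > 0" "4 * K dvd CARD('a) + 1"
    and \<beta>: "primitive_root_of_unity (8 * K) \<beta>"
  shows "(\<Prod>i\<in>{1..K}. \<Prod>\<epsilon>\<in>{1, -1}.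
      y\<^sup>2 + [:\<epsilon> * (c * quad_trace \<iota> (\<beta> ^ (2 * i - 1))):] * y + [:quad_norm \<iota> \<beta> * c\<^sup>2:]) =
    y ^ (4 * K) + [:c ^ (4 * K):]"
proof -
  let ?q = "CARD('a)" and ?P = "map_poly \<iota>"
  define z where "z = ?P y"
  define C where "C = \<iota> c"
  define w where "w = \<beta>\<^sup>2"
  note hom = map_poly_field_embedding[OF \<iota>]
  have \<iota>_hom: "\<iota> (x + y) = \<iota> x + \<iota> y" "\<iota> (x * y) = \<iota> x * \<iota> y" "\<iota> 1 = 1" for x y
    using \<iota> by (auto simp: field_embedding_def)
  have "\<iota> 0 = 0" using \<iota>_hom(1)[of 0 1] \<iota>_hom(3) by simp
  hence \<iota>_minus: "\<iota> (- x) = - \<iota> x" for x using \<iota>_hom(1)[of x "- x"] by (simp add: eq_neg_iff_add_eq_0 add.commute)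
  have w: "primitive_root_of_unity (2 * (2 * K)) w"
    unfolding w_def by (rule primitive_root_of_unity_square) (use \<beta> in simp)
  have w4: "w ^ (4 * K) = 1" using w by (simp add: primitive_root_of_unity_def mult.assoc)
  have w0: "w \<noteq> 0" using w4 K by (auto simp: power_0_left)
  obtain l where l: "?q + 1 = 4 * K * l" using K(2) by blast
  have wq: "w ^ (?q + 1) = 1" unfolding l by (simp only: power_mult[of _ "4 * K"] w4 power_one)
  \<comment> \<open>Otherwise the index set \<open>{1, -1}\<close> of the signs would collapse to one element.\<close>
  have two: "(1 :: 'a) \<noteq> -1"
  proof
    assume "(1 :: 'a) = -1"
    hence "(2 :: 'a) = 0" by (metis add.right_inverse one_add_one)
    moreover obtain r where "?q = 2 * r + 1" using q(3) by (elim oddE)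
    ultimately show False using of_nat_CARD_eq_0[where ?'a = 'a] by simp
  qed
  have pair: "?P (\<Prod>\<epsilon>\<in>{1, -1}.
        y\<^sup>2 + [:\<epsilon> * (c * quad_trace \<iota> (\<beta> ^ (2 * i - 1))):] * y + [:quad_norm \<iota> \<beta> * c\<^sup>2:]) =
      (z\<^sup>2 - [:C\<^sup>2 * w ^ (2 * i - 1):]) * (z\<^sup>2 - [:C\<^sup>2 * w ^ (2 * (2 * K + 1 - i) - 1):])"
    if i: "i \<in> {1..K}" for i
  proof -
    define a where "a = 2 * i - 1"
    define B where "B = \<beta> ^ a"
    define D where "D = \<beta> ^ (a * ?q)"
    obtain r where a: "a = 2 * r + 1" using i unfolding a_def by (cases i) auto
    have "B * D = \<beta> ^ (?q + 1) * (w ^ (?q + 1)) ^ r"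
      unfolding B_def D_def w_def a by (simp add: algebra_simps flip: power_mult power_add)
    hence norm: "\<iota> (quad_norm \<iota> \<beta>) = B * D"
      using embed_quad_norm[OF \<iota> q(2), of \<beta>] wq by simp
    have trace: "\<iota> (quad_trace \<iota> (\<beta> ^ a)) = B + D"
      using embed_quad_trace[OF \<iota> q(1,2), of "\<beta> ^ a"] by (simp add: B_def D_def power_mult)
    \<comment> \<open>The squares of both conjugates are odd powers of \<open>w\<close>: the exponent \<open>4 * K - a\<close>, which represents
      \<open>- a\<close> modulo the order of \<open>w\<close>, is the \<open>(2 * K + 1 - i)\<close>th odd number.\<close>
    have wB: "w ^ a = B\<^sup>2" by (simp add: w_def B_def mult.commute flip: power_mult)
    have "w ^ a * D\<^sup>2 = (w ^ (?q + 1)) ^ a"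
      by (simp add: w_def D_def algebra_simps flip: power_mult power_add)
    also have "\<dots> = w ^ a * w ^ (4 * K - a)"
      using i w4 wq unfolding a_def by (simp flip: power_add)
    finally have wD: "w ^ (2 * (2 * K + 1 - i) - 1) = D\<^sup>2"
      using w0 i by (simp add: a_def algebra_simps)
    have F: "?P (y\<^sup>2 + [:\<epsilon> * (c * quad_trace \<iota> (\<beta> ^ a)):] * y + [:quad_norm \<iota> \<beta> * c\<^sup>2:]) =
      (z + [:\<iota> \<epsilon> * C * B:]) * (z + [:\<iota> \<epsilon> * C * D:])" if "\<epsilon>\<^sup>2 = 1" for \<epsilon>
    proof -
      have e: "\<iota> \<epsilon> * \<iota> \<epsilon> = 1" using that \<iota>_hom(2)[of \<epsilon> \<epsilon>] \<iota>_hom(3) by (simp add: power2_eq_square)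
      have "?P (y\<^sup>2 + [:\<epsilon> * (c * quad_trace \<iota> (\<beta> ^ a)):] * y + [:quad_norm \<iota> \<beta> * c\<^sup>2:]) =
         z\<^sup>2 + [:\<iota> \<epsilon> * (C * (B + D)):] * z + [:B * D * C\<^sup>2:]"
        by (simp only: hom \<iota>_hom trace norm z_def C_def field_embedding_power[OF \<iota>])
      moreover have "[:B * D * C\<^sup>2:] = [:(\<iota> \<epsilon> * C * B) * (\<iota> \<epsilon> * C * D):]"
        using e by (simp add: power2_eq_square algebra_simps)
      ultimately show ?thesis
        by (simp add: algebra_simps power2_eq_square smult_add_left smult_add_right)
    qed
    have "?P (\<Prod>\<epsilon>\<in>{1, -1}.
        y\<^sup>2 + [:\<epsilon> * (c * quad_trace \<iota> (\<beta> ^ a)):] * y + [:quad_norm \<iota> \<beta> * c\<^sup>2:]) =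
      ((z + [:C * B:]) * (z + [:C * D:])) * ((z + [:- (C * B):]) * (z + [:- (C * D):]))"
      unfolding hom(4) using two F[of 1] F[of "-1"] by (simp add: \<iota>_hom(3) \<iota>_minus)
    also have "\<dots> = (z\<^sup>2 - [:C\<^sup>2 * B\<^sup>2:]) * (z\<^sup>2 - [:C\<^sup>2 * D\<^sup>2:])"
    proof -
      have "(z + [:x:]) * (z + [:- x:]) = z\<^sup>2 - [:x\<^sup>2:]" for x
        by (simp add: algebra_simps power2_eq_square)
      from this[of "C * B"] this[of "C * D"] show ?thesis
        by (simp only: power_mult_distrib mult.assoc mult.left_commute[of _ "z + [:- (C * B):]"])
           (simp add: mult.left_commute mult.assoc)
    qed
    finally show ?thesis unfolding wB[symmetric] wD[symmetric] unfolding a_def .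
  qed
  define G where "G = (\<lambda>i. z\<^sup>2 - [:C\<^sup>2 * w ^ (2 * i - 1):])"
  have "?P (\<Prod>i\<in>{1..K}. \<Prod>\<epsilon>\<in>{1, -1}.
      y\<^sup>2 + [:\<epsilon> * (c * quad_trace \<iota> (\<beta> ^ (2 * i - 1))):] * y + [:quad_norm \<iota> \<beta> * c\<^sup>2:]) =
      (\<Prod>i\<in>{1..K}. G i * G (2 * K + 1 - i))"
    unfolding hom(4)[of _ "{1..K}"] by (intro prod.cong refl) (simp only: pair G_def)
  also have "\<dots> = (\<Prod>i\<in>{1..K}. G i) * (\<Prod>i\<in>{K+1..2*K}. G i)"
    unfolding prod.distrib
    by (intro arg_cong2[of _ _ _ _ "(*)"] refl
          prod.reindex_bij_witness[of _ "\<lambda>i. 2 * K + 1 - i" "\<lambda>i. 2 * K + 1 - i"]) auto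
  also have "\<dots> = (\<Prod>i\<in>{1..2*K}. G i)"
  proof -
    have "{1..2*K} = {1..K} \<union> {K+1..2*K}" by auto
    thus ?thesis by (simp only:) (subst prod.union_disjoint, auto)
  qed
  also have "\<dots> = (z\<^sup>2) ^ (2 * K) + [:(C\<^sup>2) ^ (2 * K):]"
    unfolding G_def by (rule prod_minus_odd_powers[OF w])
  also have "\<dots> = ?P (y ^ (4 * K) + [:c ^ (4 * K):])"
    by (simp add: hom field_embedding_power[OF \<iota>] z_def C_def flip: power_mult)
  finally show ?thesis using hom(6) by (simp add: inj_eq)
qed

section \<open>Distinctness of the factors\<close>

text \<open>
  If \<open>F i = F j\<close> for different indices, the square of \<open>F i\<close> divides \<open>P = x\<^sup>M + 1\<close>, so \<open>F i\<close> divides both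
  \<open>P\<close> and its derivative, and therefore also the constant \<open>M P - x P' = M\<close>.
\<close>
lemma inj_on_factors_of_separable:
  fixes F :: "'i \<Rightarrow> 'a::field poly"
  assumes fin: "finite I" and dvd: "(\<Prod>i\<in>I. F i) dvd monom 1 M + 1"
    and M: "of_nat M \<noteq> (0 :: 'a)" and deg: "\<And>i. i \<in> I \<Longrightarrow> degree (F i) > 0"
  shows "inj_on F I"
proof (rule inj_onI, rule ccontr)
  fix i j assume ij: "i \<in> I" "j \<in> I" "F i = F j" "i \<noteq> j"
  have "(\<Prod>i\<in>I. F i) = F i * (F i * (\<Prod>i\<in>I - {i} - {j}. F i))"
    using ij fin by (simp add: prod.remove[of I i] prod.remove[of "I - {i}" j])
  with dvd obtain h' where "monom 1 M + 1 = F i * (F i * (\<Prod>i\<in>I - {i} - {j}. F i)) * h'"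
    by (auto elim: dvdE)
  then obtain h where h: "monom 1 M + 1 = F i * (F i * h)"
    unfolding mult.assoc by blast
  have M0: "M > 0" using M by (cases M) auto
  have "pderiv (monom 1 M + 1) = F i * pderiv (F i * h) + pderiv (F i) * (F i * h)"
    unfolding h by (simp add: pderiv_mult algebra_simps)
  hence 1: "F i dvd pderiv (monom 1 M + 1)" by simp
  have "smult (of_nat M) (monom 1 M + 1) - monom 1 1 * pderiv (monom 1 M + 1) = [:of_nat M:]"
    using M0 by (simp add: pderiv_add pderiv_monom mult_monom smult_add_right smult_monom one_pCons pderiv_pCons)
  moreover have "F i dvd monom 1 M + 1" unfolding h by simp
  ultimately have "F i dvd [:of_nat M:]"
    using 1 by (metis dvd_diff dvd_mult dvd_smult)
  hence "degree (F i) \<le> degree [:of_nat M :: 'a:]" using M by (intro dvd_imp_degree_le) auto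
  thus False using deg[OF ij(1)] by simp
qed

section \<open>Degrees of irreducible factors over a finite field\<close>

text \<open>
  The condition on the coefficients expresses \<open>degree p < m\<close> in a form that also covers the zero
  polynomial when \<open>m = 0\<close>.
\<close>
lemma card_poly_degree_less:
  fixes m :: nat
  shows "finite {p :: 'a::{finite,comm_monoid_add} poly. \<forall>i\<ge>m. coeff p i = 0} \<and>
     card {p :: 'a poly. \<forall>i\<ge>m. coeff p i = 0} = CARD('a) ^ m"
proof (induction m)
  case 0
  have "{p :: 'a poly. \<forall>i\<ge>0. coeff p i = 0} = {0}" by (auto simp: poly_eq_iff)
  thus ?case by simp
next
  case (Suc m)
  let ?S = "\<lambda>m. {p :: 'a poly. \<forall>i\<ge>m. coeff p i = 0}"
  have "?S (Suc m) = (\<lambda>(a, p). pCons a p) ` (UNIV \<times> ?S m)"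
  proof (intro equalityI subsetI)
    fix p assume p: "p \<in> ?S (Suc m)"
    obtain a r where ar: "p = pCons a r" by (cases p)
    have "coeff r i = 0" if "i \<ge> m" for i
      using p that by (auto simp: ar dest!: spec[of _ "Suc i"])
    thus "p \<in> (\<lambda>(a, p). pCons a p) ` (UNIV \<times> ?S m)" using ar by auto
  qed (auto simp: coeff_pCons split: nat.splits)
  moreover have "inj_on (\<lambda>(a, p). pCons a p) (UNIV \<times> ?S m)" by (auto simp: inj_on_def)
  ultimately show ?case using Suc by (simp add: card_image card_cartesian_product)
qed

text \<open>
  Fermat's little theorem for the residue field of \<open>f\<close>, proved without constructing this field:
  multiplication by \<open>g\<close> modulo \<open>f\<close> permutes the nonzero residues, that is, the nonzero polynomials of
  degree less than \<open>degree f\<close>. Comparing the product of all of them before and after the permutation, and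
  cancelling it, leaves the claim.
\<close>
lemma fermat_poly:
  fixes f g :: "'a::finite_field poly"
  assumes f: "irreducible f" and g: "\<not> f dvd g"
  shows "[g ^ (CARD('a) ^ degree f - 1) = 1] (mod f)"
proof -
  have pr: "prime_elem f" by (rule field_poly_irreducible_imp_prime[OF f])
  have f0: "f \<noteq> 0" using f by auto
  have df: "degree f > 0"
    using f f0 by (auto simp: irreducible_def is_unit_iff_degree)
  let ?R = "{p :: 'a poly. \<forall>i\<ge>degree f. coeff p i = 0}"
  have R: "p \<in> ?R \<longleftrightarrow> degree p < degree f" for p
  proof
    show "degree p < degree f" if "p \<in> ?R"
      using that df by (cases "p = 0") (auto dest!: spec[of _ "degree p"] intro: ccontr)
  qed (auto intro: coeff_eq_0)
  let ?S = "?R - {0}"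
  have fin: "finite ?S" and card: "card ?S = CARD('a) ^ degree f - 1"
    using card_poly_degree_less[where ?'a = 'a, of "degree f"] by simp_all
  have nd: "\<not> f dvd p" if "p \<in> ?S" for p
    using that R[of p] by (auto dest: dvd_imp_degree_le)
  have mod_S: "p mod f \<in> ?S" if "\<not> f dvd p" for p
    using that R[of "p mod f"] degree_mod_less[OF f0, of p] df by (auto simp: dvd_eq_mod_eq_0)
  have ndg: "\<not> f dvd g * p" if "p \<in> ?S" for p
    using nd[OF that] g pr by (simp add: prime_elem_dvd_mult_iff)
  have inj: "inj_on (\<lambda>p. (g * p) mod f) ?S"
  proof (rule inj_onI)
    fix p r assume pr: "p \<in> ?S" "r \<in> ?S" "(g * p) mod f = (g * r) mod f"
    hence "f dvd g * (p - r)" by (simp add: right_diff_distrib mod_eq_dvd_iff)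
    hence "f dvd p - r" using g \<open>prime_elem f\<close> by (simp add: prime_elem_dvd_mult_iff)
    moreover have "degree (p - r) < degree f"
      using pr R[of p] R[of r] by (intro degree_diff_less) auto
    ultimately show "p = r" by (metis dvd_imp_degree_le eq_iff_diff_eq_0 not_le)
  qed
  have "(\<lambda>p. (g * p) mod f) ` ?S = ?S"
    by (rule endo_inj_surj[OF fin _ inj]) (intro image_subsetI mod_S ndg)
  hence "(\<Prod>p\<in>?S. p) = (\<Prod>p\<in>?S. (g * p) mod f)"
    using prod.reindex[OF inj, of "\<lambda>p. p"] by simp
  also have "[\<dots> = (\<Prod>p\<in>?S. g * p)] (mod f)"
    by (rule cong_prod) simp
  also have "(\<Prod>p\<in>?S. g * p) = g ^ card ?S * (\<Prod>p\<in>?S. p)"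
    by (simp add: prod.distrib)
  finally have prod: "f dvd (g ^ card ?S - 1) * (\<Prod>p\<in>?S. p)"
    by (simp add: cong_iff_dvd_diff algebra_simps dvd_diff_commute)
  have "\<not> f dvd (\<Prod>p\<in>A. p)" if "finite A" "A \<subseteq> ?S" for A
    using that
  proof (induction A rule: finite_induct)
    case empty
    show ?case using pr by (simp add: prime_elem_not_unit)
  next
    case (insert p A)
    have "\<not> f dvd p" using insert.prems by (intro nd) simp
    thus ?case using insert pr by (simp add: prime_elem_dvd_mult_iff)
  qed
  from this[OF fin subset_refl] have "f dvd g ^ card ?S - 1"
    using prime_elem_dvd_multD[OF pr prod] by (simp only: simp_thms)
  thus ?thesis by (simp add: cong_iff_dvd_diff card)
qed

text \<open>
  Let \<open>E = q\<^sup>m - 1 = 2\<^sup>r e\<close> with \<open>e\<close> odd, where \<open>m = degree f\<close>, and suppose that \<open>r < n\<close>. Then \<open>E\<close> divides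
  \<open>2\<^bsup>n-1\<^esup> d e\<close>, so \<open>x\<close> raised to this exponent is \<open>1\<close> modulo \<open>f\<close>; but it is also \<open>(-1)\<^sup>e = -1\<close>.
\<close>
lemma dvd_card_power_minus_one:
  fixes f :: "'a::finite_field poly"
  assumes f: "irreducible f" and dvd: "f dvd monom 1 (2 ^ (n - 1) * d) + 1" and "odd d" "n \<ge> 1"
    and two: "(2 :: 'a) \<noteq> 0"
  shows "2 ^ n dvd CARD('a) ^ degree f - 1"
proof (rule ccontr)
  let ?X = "monom 1 1 :: 'a poly" and ?E = "CARD('a) ^ degree f - 1"
  assume n: "\<not> 2 ^ n dvd ?E"
  have ndc: "\<not> f dvd [:c:]" if "c \<noteq> 0" for c
    using f that by (auto simp: irreducible_def is_unit_iff_degree dest: dvd_imp_degree_le)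
  have X: "monom 1 m = ?X ^ m" for m by (simp add: monom_power)
  have neg: "[?X ^ (2 ^ (n - 1) * d) = -1] (mod f)"
    using dvd X[of "2 ^ (n - 1) * d"] by (simp add: cong_iff_dvd_diff)
  have "\<not> f dvd ?X"
  proof
    assume "f dvd ?X"
    hence "f dvd monom 1 (2 ^ (n - 1) * d)" unfolding X[of "2 ^ (n - 1) * d"]
      using odd_pos[OF \<open>odd d\<close>] by (intro dvd_trans[OF _ dvd_power]) auto
    hence "f dvd 1" using dvd by (simp add: dvd_add_right_iff)
    thus False using ndc[of 1] by (simp add: one_pCons)
  qed
  hence fermat: "[?X ^ ?E = 1] (mod f)" by (rule fermat_poly[OF f])
  have "?E \<noteq> 0" using n by (metis dvd_0_right)
  then obtain r e where re: "?E = 2 ^ r * e" "odd e"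
    using multiplicity_decompose'[of ?E 2] by (metis odd_one)
  have "r \<le> n - 1"
    using n \<open>n \<ge> 1\<close> re by (metis Suc_diff_1 Suc_leI dvd_mult2 le_imp_power_dvd not_less not_less_eq_eq One_nat_def less_eq_Suc_le)
  hence "?E dvd 2 ^ (n - 1) * d * e"
    unfolding re by (simp add: le_imp_power_dvd mult_dvd_mono)
  then obtain h where h: "2 ^ (n - 1) * d * e = ?E * h" by blast
  have E: "[?X ^ (?E * h) = 1 ^ h] (mod f)" unfolding power_mult by (rule cong_pow[OF fermat])
  have "[?X ^ (2 ^ (n - 1) * d * e) = (-1) ^ e] (mod f)"
    unfolding power_mult[of _ "2 ^ (n - 1) * d"] by (rule cong_pow[OF neg])
  hence "[?X ^ (?E * h) = -1] (mod f)"
    unfolding h neg_one_odd_power[OF re(2)] .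
  with E have "[1 = -1 :: 'a poly] (mod f)"
    unfolding power_one by (rule cong_trans[OF cong_sym])
  hence "f dvd [:2:]" by (simp add: cong_iff_dvd_diff one_pCons)
  thus False using ndc[of 2] two by simp
qed

text \<open>
  A nonconstant divisor of least degree is irreducible and, by the assumption, has the degree of \<open>F\<close>,
  hence differs from \<open>F\<close> by a unit.
\<close>
lemma irreducible_if_factor_degrees:
  fixes F :: "'a::field poly"
  assumes "degree F > 0" and "\<And>f. irreducible f \<Longrightarrow> f dvd F \<Longrightarrow> degree F \<le> degree f"
  shows "irreducible F"
proof -
  define P where "P = (\<lambda>f. f dvd F \<and> degree f > 0)"
  have "P F" using assms by (simp add: P_def)
  then obtain f where f: "P f" and min: "\<And>g. P g \<Longrightarrow> degree f \<le> degree g"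
    using ex_has_least_nat[of P F degree] by blast
  have F0: "F \<noteq> 0" using assms by auto
  hence f0: "f \<noteq> 0" using f by (auto simp: P_def)
  have irr: "irreducible f"
  proof (rule irreducibleI)
    fix a b assume ab: "f = a * b"
    hence ab0: "a \<noteq> 0" "b \<noteq> 0" using f0 by auto
    have deg: "degree f = degree a + degree b" unfolding ab using ab0 by (rule degree_mult_eq)
    have "degree a = 0 \<or> degree f \<le> degree a"
      using min[of a] f dvd_mult_left[of a b F] by (auto simp: P_def ab)
    thus "a dvd 1 \<or> b dvd 1" using deg ab0 by (auto simp: is_unit_iff_degree)
  qed (use f f0 in \<open>auto simp: P_def is_unit_iff_degree\<close>)
  have "degree F \<le> degree f" using assms(2) irr f by (simp add: P_def)
  obtain h where h: "F = f * h" using f by (auto simp: P_def)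
  hence "h \<noteq> 0" using F0 by auto
  hence "degree F = degree f + degree h" unfolding h using f0 by (intro degree_mult_eq)
  hence "is_unit h" using \<open>degree F \<le> degree f\<close> \<open>h \<noteq> 0\<close> by (simp add: is_unit_iff_degree)
  thus ?thesis using irr by (simp add: h irreducible_mult_unit_left mult.commute[of f])
qed

text \<open>
  The number \<open>q\<close> of elements vanishes in the field, so \<open>q - 1\<close> and with it each of its divisors is
  invertible.
\<close>
lemma odd_card_nonzero:
  assumes "odd CARD('a::finite_field)" "d dvd CARD('a) - 1"
  shows "(2 :: 'a) \<noteq> 0" "of_nat d \<noteq> (0 :: 'a)"
proof -
  have nz: "of_nat e \<noteq> (0 :: 'a)" if dvd: "e dvd CARD('a) - 1" for e
  proof
    assume e: "of_nat e = (0 :: 'a)"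
    obtain h where h: "CARD('a) - 1 = e * h" using dvd by (elim dvdE)
    have "of_nat CARD('a) = (of_nat (e * h + 1) :: 'a)"
      unfolding h[symmetric] by simp
    thus False using e of_nat_CARD_eq_0[where ?'a = 'a] by simp
  qed
  show "of_nat d \<noteq> (0 :: 'a)" using nz assms by simp
  show "(2 :: 'a) \<noteq> 0" using nz[of 2] assms by simp
qed

text \<open>
  What the two congruence classes of \<open>q\<close> have in common: a factorization of \<open>\<Phi> (2\<^sup>n d)\<close> into polynomials
  of equal degree has no repeated factors, and a lower bound \<open>D\<close> for the exponents \<open>m\<close> with \<open>2\<^sup>n\<close>
  dividing \<open>q\<^sup>m - 1\<close> makes factors of degree \<open>D\<close> irreducible.
\<close>
lemma cyclotomic_factors_inj_irreducible:
  fixes F :: "'i \<Rightarrow> 'a::finite_field poly"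
  assumes eq: "cyclotomic (2 ^ n * d) = (\<Prod>i\<in>I. F i)" and fin: "finite I"
    and n: "n \<ge> 1" and d: "prime d" "odd d"
    and nz: "(2 :: 'a) \<noteq> 0" "of_nat d \<noteq> (0 :: 'a)"
    and deg: "\<And>i. i \<in> I \<Longrightarrow> degree (F i) = D" "D > 0"
  shows "inj_on F I"
    and "(\<And>m. m > 0 \<Longrightarrow> 2 ^ n dvd CARD('a) ^ m - 1 \<Longrightarrow> D \<le> m) \<Longrightarrow> i \<in> I \<Longrightarrow> irreducible (F i)"
proof -
  have dvd: "(\<Prod>i\<in>I. F i) dvd monom 1 (2 ^ (n - 1) * d) + 1"
    using cyclotomic_two_power_prime_mult[OF n d, where ?'a = 'a] unfolding eq by (metis dvd_triv_left)
  show "inj_on F I"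
    by (rule inj_on_factors_of_separable[OF fin dvd]) (use nz deg in auto)
  assume order: "\<And>m. m > 0 \<Longrightarrow> 2 ^ n dvd CARD('a) ^ m - 1 \<Longrightarrow> D \<le> m" and i: "i \<in> I"
  show "irreducible (F i)"
  proof (rule irreducible_if_factor_degrees)
    fix f assume f: "irreducible f" "f dvd F i"
    hence "f dvd monom 1 (2 ^ (n - 1) * d) + 1"
      using dvd i fin by (meson dvd_prodI dvd_trans)
    hence "2 ^ n dvd CARD('a) ^ degree f - 1"
      using f d n nz by (intro dvd_card_power_minus_one[of f n d]) auto
    moreover have "degree f > 0"
      using f by (auto simp: irreducible_def is_unit_iff_degree)
    ultimately show "degree (F i) \<le> degree f" using order i deg by simp
  qed (use deg i in simp)
qed

section \<open>Powers of two dividing powers minus one\<close>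

text \<open>
  The exact power of two in \<open>a\<^bsup>2^r e\<^esup> - 1\<close>. An odd exponent \<open>e\<close> contributes a geometric sum of \<open>e\<close> odd
  terms, which is odd. Each squaring then contributes exactly one more factor two, because the sum of a
  number that is \<open>1\<close> modulo \<open>4\<close> and \<open>1\<close> is twice an odd number.
\<close>
lemma two_adic_power:
  fixes a c s :: nat
  assumes "a = 2 ^ s * c + 1" "odd c" "s \<ge> 2" "odd e"
  shows "\<exists>c'. odd c' \<and> a ^ (2 ^ r * e) = 2 ^ (s + r) * c' + 1"
proof (induction r)
  case 0
  have "odd (\<Sum>i<e. a ^ i)"
    using assms by (simp add: even_sum_iff)
  moreover have "a ^ e = (a - 1) * (\<Sum>i<e. a ^ i) + 1"
  proof -
    have "(b + 1) ^ e = b * (\<Sum>i<e. (b + 1) ^ i) + 1" for b :: nat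
      by (induction e) (simp_all add: algebra_simps)
    from this[of "a - 1"] show ?thesis using assms by simp
  qed
  ultimately show ?case using assms
    by (intro exI[of _ "c * (\<Sum>i<e. a ^ i)"]) simp
next
  case (Suc r)
  then obtain c' where c': "odd c'" "a ^ (2 ^ r * e) = 2 ^ (s + r) * c' + 1" by blast
  have "a ^ (2 ^ Suc r * e) = (a ^ (2 ^ r * e))\<^sup>2" by (simp add: mult_ac flip: power_mult)
  also have "\<dots> = 2 ^ (s + Suc r) * (c' * (2 ^ (s + r - 1) * c' + 1)) + 1"
  proof -
    have "2 ^ (s + r) = 2 * (2 :: nat) ^ (s + r - 1)" using assms by (cases "s + r") auto
    thus ?thesis unfolding c' by (simp add: power2_eq_square algebra_simps)
  qed
  finally have "a ^ (2 ^ Suc r * e) = \<dots>" .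
  moreover have "odd (c' * (2 ^ (s + r - 1) * c' + 1))" using c' assms by auto
  ultimately show ?case by blast
qed

lemma two_adic_order:
  fixes a c s m :: nat
  assumes "a = 2 ^ s * c + 1" "odd c" "s \<ge> 2" "m > 0" "2 ^ n dvd a ^ m - 1"
  shows "2 ^ (n - s) dvd m"
proof -
  obtain r e where re: "m = 2 ^ r * e" "odd e"
    using multiplicity_decompose'[of m 2] \<open>m > 0\<close> by (metis less_numeral_extra(3) odd_one)
  obtain c' where c': "odd c'" "a ^ m = 2 ^ (s + r) * c' + 1"
    using two_adic_power[OF assms(1-3) re(2), of r] re by blast
  have "2 ^ n dvd 2 ^ (s + r) * c'" using assms c' by simp
  moreover have "coprime (2 ^ n) c'" using c'(1) by simp
  ultimately have "(2::nat) ^ n dvd 2 ^ (s + r)" by (simp add: coprime_dvd_mult_left_iff)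
  hence "n \<le> s + r" using power_dvd_imp_le[of 2 n "s + r"] by simp
  thus ?thesis unfolding re by (intro dvd_mult2 le_imp_power_dvd) simp
qed

text \<open>
  In \<open>2\<^sup>u v = (q + 1)(q - 1)\<close> the second factor is twice an odd number, so all but one of the factors two
  sit in \<open>q + 1\<close>.
\<close>
lemma two_power_dvd_Suc_if_3_mod_4:
  fixes q :: nat
  assumes "[q = 3] (mod 4)" "q\<^sup>2 = 2 ^ u * v + 1" "u \<ge> 1"
  shows "2 ^ (u - 1) dvd q + 1"
proof -
  obtain w where w: "q = 4 * w + 3"
  proof
    have "q mod 4 = 3" using assms(1) by (simp add: cong_def)
    thus "q = 4 * (q div 4) + 3" using mult_div_mod_eq[of 4 q] by simp
  qed
  have "2 * 2 ^ (u - 1) * v = 2 ^ u * v" using assms(3) by (cases u) auto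
  also have "\<dots> = (q + 1) * (q - 1)" using assms(2) by (simp add: algebra_simps power2_eq_square)
  also have "\<dots> = 2 * ((2 * w + 1) * (q + 1))" unfolding w by (simp add: algebra_simps)
  finally have "2 ^ (u - 1) * v = (2 * w + 1) * (q + 1)" by simp
  hence "2 ^ (u - 1) dvd (2 * w + 1) * (q + 1)" by (metis dvd_triv_left)
  moreover have "coprime (2 ^ (u - 1)) (2 * w + 1)" by simp
  ultimately show ?thesis by (simp only: coprime_dvd_mult_right_iff)
qed

text \<open>
  An odd power of \<open>q\<close> is \<open>3\<close> modulo \<open>4\<close>, so \<open>m\<close> is even and \<open>two_adic_order\<close> can be applied to
  the powers of \<open>q\<^sup>2\<close>.
\<close>
lemma two_adic_order_3_mod_4:
  fixes q :: nat
  assumes "[q = 3] (mod 4)" "q\<^sup>2 = 2 ^ u * v + 1" "odd v" "3 \<le> u" "u \<le> n"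
    and "m > 0" "2 ^ n dvd q ^ m - 1"
  shows "2 ^ (n - u + 1) dvd m"
proof -
  have q0: "q ^ m \<ge> 1" using assms(1) by (cases q) (auto simp: cong_def)
  have "even m"
  proof (rule ccontr)
    assume "odd m"
    have "(2::nat) ^ 2 dvd 2 ^ n" using assms by (intro le_imp_power_dvd) simp
    hence "4 dvd q ^ m - 1" using assms(7) by (metis dvd_trans power2_eq_square numeral_times_numeral semiring_norm(13,11,12))
    hence "[q ^ m = 1] (mod 4)" using q0 by (simp add: cong_altdef_nat)
    moreover have "[q ^ m = 3 ^ m] (mod 4)" by (rule cong_pow[OF assms(1)])
    moreover have "[3 ^ m = (3::nat)] (mod 4)"
    proof -
      obtain l where l: "m = 2 * l + 1" using \<open>odd m\<close> by (elim oddE)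
      have "[9 ^ l = 1 ^ l] (mod (4::nat))" by (rule cong_pow) (simp add: cong_def)
      hence "[9 ^ l * 3 = 1 * 3] (mod (4::nat))" by (intro cong_mult) auto
      thus ?thesis unfolding l power_add power_mult by simp
    qed
    ultimately have "[3 = (1::nat)] (mod 4)" by (meson cong_sym cong_trans)
    thus False by (simp add: cong_def)
  qed
  then obtain l where l: "m = 2 * l" by blast
  have "2 ^ (n - u) dvd l"
  proof (rule two_adic_order[OF assms(2,3)])
    show "2 ^ n dvd (q\<^sup>2) ^ l - 1" using assms(7) unfolding l power_mult .
  qed (use assms l in auto)
  thus ?thesis unfolding l by simp
qed

section \<open>The factorizations\<close>

lemma cyclotomic_factorization_1_mod_4:
  fixes \<alpha> \<gamma> :: "'a::finite_field" and s t d k n :: nat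
  defines "F \<equiv> \<lambda>(i, j). monom 1 (2 ^ (n - k)) - [:\<alpha> ^ (2 * i - 1) * \<gamma> ^ j:]"
    and "I \<equiv> {1..2 ^ (k - 1)} \<times> {1..d - 1}"
  assumes q: "CARD('a) = 2 ^ s * t + 1" "odd t"
    and d: "prime d" "odd d" "d dvd CARD('a) - 1" and \<gamma>: "primitive_root_of_unity d \<gamma>"
    and k: "2 \<le> k" "k \<le> s" "k \<le> n" and \<alpha>: "primitive_root_of_unity (2 ^ k) \<alpha>"
  shows "cyclotomic (2 ^ n * d) = (\<Prod>ij\<in>I. F ij)" and "card (F ` I) = 2 ^ (k - 1) * (d - 1)"
    and "k = s \<Longrightarrow> ij \<in> I \<Longrightarrow> irreducible (F ij)"
proof -
  let ?N = "2 ^ (k - 1) :: nat" and ?y = "monom 1 (2 ^ (n - k)) :: 'a poly"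
  have \<alpha>': "primitive_root_of_unity (2 * ?N) \<alpha>"
    using \<alpha> k by (cases k) auto
  have "2 ^ (n - 1) = 2 ^ (n - k) * ?N" using k by (simp flip: power_add)
  hence y: "?y ^ ?N = monom 1 (2 ^ (n - 1))" by (simp add: monom_power)
  have "(\<Prod>ij\<in>I. F ij) = (\<Prod>i\<in>{1..?N}. \<Prod>j\<in>{1..d-1}. F (i, j))"
    unfolding I_def by (simp add: prod.cartesian_product)
  also have "\<dots> = (\<Prod>j\<in>{1..d-1}. \<Prod>i\<in>{1..?N}. F (i, j))"
    by (rule prod.swap)
  also have "\<dots> = (\<Prod>j\<in>{1..d-1}. ?y ^ ?N + [:(\<gamma> ^ j) ^ ?N:])"
    unfolding prod_minus_odd_powers[OF \<alpha>', symmetric] by (simp add: F_def mult.commute)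
  also have "\<dots> = cyclotomic (2 ^ n * d)"
    unfolding y using d \<gamma> k by (subst cyclotomic_eq_prod) auto
  finally show eq: "cyclotomic (2 ^ n * d) = (\<Prod>ij\<in>I. F ij)" ..
  have deg: "degree (F ij) = 2 ^ (n - k)" for ij
  proof -
    obtain i j where ij: "ij = (i, j)" by (cases ij)
    show ?thesis
      unfolding F_def ij diff_conv_add_uminus by (simp add: degree_add_eq_left degree_monom_eq)
  qed
  have fin: "finite I" by (simp add: I_def)
  have "even (2 ^ s)" using k by simp
  hence "odd CARD('a)" using q by simp
  note nz = odd_card_nonzero[OF this d(3)]
  have n: "n \<ge> 1" using k by simp
  note * = cyclotomic_factors_inj_irreducible[OF eq fin n d(1,2) nz deg]
  show "card (F ` I) = 2 ^ (k - 1) * (d - 1)"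
    using *(1) by (simp add: card_image) (simp add: I_def)
  assume "k = s" "ij \<in> I"
  show "irreducible (F ij)"
  proof (rule *(2))
    fix m :: nat assume m: "m > 0" "2 ^ n dvd CARD('a) ^ m - 1"
    hence "2 ^ (n - s) dvd m"
      using q k by (intro two_adic_order[of "CARD('a)" s t]) auto
    thus "2 ^ (n - k) \<le> m" using m \<open>k = s\<close> by (auto dest: dvd_imp_le)
  qed (use \<open>ij \<in> I\<close> in auto)
qed

lemma cyclotomic_factorization_3_mod_4:
  fixes \<iota> :: "'a::finite_field \<Rightarrow> 'b::finite_field" and \<beta> :: 'b and \<gamma> :: 'a and u v d k n :: nat
  defines "F \<equiv> \<lambda>(i, j, \<epsilon>). monom 1 (2 ^ (n - k + 1))
       + monom (\<epsilon> * (\<gamma> ^ j * quad_trace \<iota> (\<beta> ^ (2 * i - 1)))) (2 ^ (n - k))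
       + [: quad_norm \<iota> \<beta> * \<gamma> ^ (2 * j) :]"
    and "I \<equiv> {1..2 ^ (k - 3)} \<times> {1..d - 1} \<times> {1, - 1}"
  assumes q: "primepow CARD('a)" "[CARD('a) = 3] (mod 4)" "CARD('a)\<^sup>2 = 2 ^ u * v + 1" "odd v"
    and \<iota>: "field_embedding \<iota>" "CARD('b) = CARD('a)\<^sup>2"
    and d: "prime d" "odd d" "d dvd CARD('a) - 1" and \<gamma>: "primitive_root_of_unity d \<gamma>"
    and k: "3 \<le> k" "k \<le> u" "k \<le> n" and \<beta>: "primitive_root_of_unity (2 ^ k) \<beta>"
  shows "cyclotomic (2 ^ n * d) = (\<Prod>ij\<in>I. F ij)" and "card (F ` I) = 2 ^ (k - 2) * (d - 1)"
    and "k = u \<Longrightarrow> ij \<in> I \<Longrightarrow> irreducible (F ij)"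
proof -
  let ?K = "2 ^ (k - 3) :: nat" and ?y = "monom 1 (2 ^ (n - k)) :: 'a poly"
  have "[CARD('a) = 3] (mod 2)" using cong_dvd_modulus_nat[OF q(2), of 2] by simp
  hence odd: "odd CARD('a)" by (simp add: cong_def odd_iff_mod_2_eq_one)
  have kK: "2 ^ k = 8 * ?K" "2 ^ (k - 1) = 4 * ?K" "2 ^ (k - 2) = 2 * ?K"
  proof -
    have "k = (k - 3) + 3" "k - 1 = (k - 3) + 2" "k - 2 = (k - 3) + 1" using k(1) by simp_all
    hence *: "2 ^ k = ?K * 2 ^ 3" "2 ^ (k - 1) = ?K * 2 ^ 2" "2 ^ (k - 2) = ?K * 2 ^ 1"
      by (metis power_add)+
    show "2 ^ k = 8 * ?K" unfolding *(1) by simp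
    show "2 ^ (k - 1) = 4 * ?K" unfolding *(2) by simp
    show "2 ^ (k - 2) = 2 * ?K" unfolding *(3) by simp
  qed
  have "2 ^ (k - 1) dvd (2 ^ (u - 1) :: nat)" using k by (intro le_imp_power_dvd) simp
  moreover have "2 ^ (u - 1) dvd CARD('a) + 1"
    using k by (intro two_power_dvd_Suc_if_3_mod_4[OF q(2,3)]) simp
  ultimately have K: "4 * ?K dvd CARD('a) + 1" unfolding kK(2) by (rule dvd_trans)
  have \<beta>': "primitive_root_of_unity (8 * ?K) \<beta>" using \<beta> by (simp add: kK)
  have "2 ^ (n - 1) = 2 ^ (n - k) * (2::nat) ^ (k - 1)" using k by (simp flip: power_add)
  hence y: "?y ^ (4 * ?K) = monom 1 (2 ^ (n - 1))"
    unfolding kK(2)[symmetric] by (simp add: monom_power)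
  have F: "F (i, j, \<epsilon>) = ?y\<^sup>2 + [:\<epsilon> * (\<gamma> ^ j * quad_trace \<iota> (\<beta> ^ (2 * i - 1))):] * ?y + [:quad_norm \<iota> \<beta> * (\<gamma> ^ j)\<^sup>2:]"
    for i j \<epsilon>
    by (simp add: F_def monom_power smult_monom mult.commute flip: power_mult)
  have "(\<Prod>ij\<in>I. F ij) = (\<Prod>i\<in>{1..?K}. \<Prod>j\<in>{1..d-1}. \<Prod>\<epsilon>\<in>{1,-1}. F (i, j, \<epsilon>))"
    unfolding I_def by (simp only: prod.cartesian_product case_prod_eta split_def prod.collapse)
  also have "\<dots> = (\<Prod>j\<in>{1..d-1}. \<Prod>i\<in>{1..?K}. \<Prod>\<epsilon>\<in>{1,-1}. F (i, j, \<epsilon>))"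
    by (rule prod.swap)
  also have "\<dots> = (\<Prod>j\<in>{1..d-1}. ?y ^ (4 * ?K) + [:(\<gamma> ^ j) ^ (4 * ?K):])"
    unfolding F by (intro prod.cong refl prod_trace_factors[OF \<iota>(1) q(1) \<iota>(2) odd _ K \<beta>']) simp
  also have "\<dots> = cyclotomic (2 ^ n * d)"
    unfolding y using d \<gamma> k by (subst cyclotomic_eq_prod[where N = "4 * ?K"]) (auto simp flip: kK)
  finally show eq: "cyclotomic (2 ^ n * d) = (\<Prod>ij\<in>I. F ij)" ..
  have deg: "degree (F ij) = 2 ^ (n - k + 1)" for ij
  proof -
    obtain i j \<epsilon> where ij: "ij = (i, j, \<epsilon>)" by (cases ij)
    have "degree (monom (\<epsilon> * (\<gamma> ^ j * quad_trace \<iota> (\<beta> ^ (2 * i - 1)))) (2 ^ (n - k))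
       + [: quad_norm \<iota> \<beta> * \<gamma> ^ (2 * j) :]) \<le> 2 ^ (n - k)"
      by (intro degree_add_le degree_monom_le) simp
    also have "\<dots> < degree (monom (1::'a) (2 ^ (n - k + 1)))" by (simp add: degree_monom_eq)
    finally show ?thesis unfolding F_def ij by (simp add: add.assoc degree_add_eq_left degree_monom_eq)
  qed
  have fin: "finite I" by (simp add: I_def)
  note nz = odd_card_nonzero[OF odd d(3)]
  have n: "n \<ge> 1" using k by simp
  note * = cyclotomic_factors_inj_irreducible[OF eq fin n d(1,2) nz deg]
  have "(1 :: 'a) \<noteq> -1" using nz(1) by (metis add.right_inverse one_add_one)
  hence "card I = 2 ^ (k - 2) * (d - 1)" unfolding kK(3) by (simp add: I_def)
  thus "card (F ` I) = 2 ^ (k - 2) * (d - 1)" using *(1) by (simp add: card_image)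
  assume "k = u" "ij \<in> I"
  show "irreducible (F ij)"
  proof (rule *(2))
    fix m :: nat assume m: "m > 0" "2 ^ n dvd CARD('a) ^ m - 1"
    have "2 ^ (n - k + 1) dvd m"
      using two_adic_order_3_mod_4[OF q(2-4) _ _ m] k \<open>k = u\<close> by simp
    thus "2 ^ (n - k + 1) \<le> m" using m by (auto dest: dvd_imp_le)
  qed (use \<open>ij \<in> I\<close> in auto)
qed

theorem corollary3p1:
  fixes q s t d :: nat and \<gamma> :: "'a::finite_field"
  assumes "primepow q" "odd q" "CARD('a) = q"
    and "q = 2 ^ s * t + 1" "s \<ge> 1" "odd t"
    and "prime d" "odd d" "d dvd q - 1"
    and "primitive_root_of_unity d \<gamma>"
  shows
    "([q = 1] (mod 4) \<longrightarrow>
        (\<forall>k n (\<alpha> :: 'a).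
           2 \<le> k \<and> k \<le> s \<and> k \<le> n \<and> primitive_root_of_unity (2 ^ k) \<alpha> \<longrightarrow>
           (let I = {1..2 ^ (k - 1)} \<times> {1..d - 1};
                F = (\<lambda>(i, j). monom 1 (2 ^ (n - k)) - [: \<alpha> ^ (2 * i - 1) * \<gamma> ^ j :])
            in cyclotomic (2 ^ n * d) = (\<Prod>ij\<in>I. F ij) \<and>
               card (F ` I) = 2 ^ (k - 1) * (d - 1) \<and>
               (k = s \<longrightarrow> (\<forall>ij\<in>I. irreducible (F ij))))))
     \<and>
     ([q = 3] (mod 4) \<longrightarrow>
        (\<forall>u v (\<iota> :: 'a \<Rightarrow> 'b::finite_field).
           CARD('b) = q\<^sup>2 \<and> field_embedding \<iota> \<and> q\<^sup>2 = 2 ^ u * v + 1 \<and> odd v \<longrightarrow>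
           (\<forall>k n (\<beta> :: 'b).
              3 \<le> k \<and> k \<le> u \<and> k \<le> n \<and> primitive_root_of_unity (2 ^ k) \<beta> \<longrightarrow>
              (let I = {1..2 ^ (k - 3)} \<times> {1..d - 1} \<times> {1, - 1};
                   F = (\<lambda>(i, j, \<epsilon>).
                          monom 1 (2 ^ (n - k + 1))
                          + monom (\<epsilon> * (\<gamma> ^ j * quad_trace \<iota> (\<beta> ^ (2 * i - 1)))) (2 ^ (n - k))
                          + [: quad_norm \<iota> \<beta> * \<gamma> ^ (2 * j) :])
               in cyclotomic (2 ^ n * d) = (\<Prod>ij\<in>I. F ij) \<and>
                  card (F ` I) = 2 ^ (k - 2) * (d - 1) \<and>
                  (k = u \<longrightarrow> (\<forall>ij\<in>I. irreducible (F ij)))))))"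
proof (intro conjI impI allI, goal_cases)
  case (1 k n \<alpha>)
  have d: "d dvd CARD('a) - 1" and q: "CARD('a) = 2 ^ s * t + 1" using assms by simp_all
  show ?case
    unfolding Let_def
    using 1 cyclotomic_factorization_1_mod_4[OF q assms(6-8) d assms(10), of k n \<alpha>] by blast
next
  case (2 u v \<iota> k n \<beta>)
  have d: "d dvd CARD('a) - 1" and q: "primepow CARD('a)" "[CARD('a) = 3] (mod 4)"
    "CARD('a)\<^sup>2 = 2 ^ u * v + 1" "odd v"
    and \<iota>: "field_embedding \<iota>" "CARD('b) = CARD('a)\<^sup>2"
    using assms 2 by simp_all
  show ?case
    unfolding Let_def
    using 2 cyclotomic_factorization_3_mod_4[OF q \<iota> assms(7,8) d assms(10), of k n \<beta>] by blast
qed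

end
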